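(* Let $n \ge 1$ be an integer, let $\mathrm{Sym}(n)$ denote the symmetric group of $\{0,1,\dots,n-1\}$, and consider its generating set $S^0_n = \{(0,i) \mid 1 \le i \le n-1\}$. The corresponding growth polynomial and conjugacy growth polynomial are $$L_{\mathrm{Sym}(n), S^0_n}(q) = 1 + \sum_{m=2}^{n-1} \binom{n-1}{m} \sum_{k=1}^{\lfloor m/2 \rfloor} d_k(m) q^{m+k} + \sum_{m=2}^{n} \binom{n-1}{m-1} \sum_{k=1}^{\lfloor m/2 \rfloor} d_k(m) q^{m+k-2},$$ $$C_{\mathrm{Sym}(n), S^0_n}(q) = 1 + \sum_{k=1}^{\lfloor n/2 \rfloor} q^{2k-2} \sum_{j=k}^{n} p_k(j) q^j.$$
   Context: For a finite group $G$ generated by a set $S$: the word length $\ell_{G,S}(g)$ is the smallest $r \ge 0$ such that $g = s_1 \cdots s_r$ with $s_i \in S \cup S^{-1}$; the conjugacy length $\kappa_{G,S}(g)$ is the minimum of $\ell_{G,S}(h)$ over all $h$ in the conjugacy class of $g$. The growth polynomial is $L_{G,S}(q) = \sum_{g \in G} q^{\ell_{G,S}(g)}$. The conjugacy growth polynomial is $C_{G,S}(q) = \sum q^{\kappa_{G,S}(g)}$, the sum being over a set of representatives $g$ of the conjugacy classes of $G$. $(0,i)$ denotes the transposition exchanging $0$ and $i$. $d_k(m)$ is the number of derangements (fixed-point-free permutations) of $\{1,\dots,m\}$ that are products of exactly $k$ disjoint cycles (each of length at least $2$). $p_k(j)$ is the number of partitions of $j$ into exactly $k$ positive parts.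
   Formalization: In the formula for C the inner sum over j runs from k to n-k instead of from k to n; the printed upper limit n is false for every n ≥ 2 (for n = 2 it gives 1+q+q^2, while Sym(2) has two conjugacy classes and C = 1+q). *)

theory Defs
  imports
    "HOL-Algebra.Generated_Groups"
    "HOL-Combinatorics.Cycles"
    "HOL-Computational_Algebra.Polynomial"
    "HOL-Library.Multiset"
begin

section \<open>Growth and conjugacy growth of a finite group\<close>

text \<open>The empty word represents the unit. All notions below are meant for a finite group \<open>G\<close>
  and \<open>S \<subseteq> carrier G\<close> generating \<open>G\<close>; otherwise \<open>LEAST\<close>, \<open>Min\<close> or the sums may be
  unspecified or degenerate.\<close>

definition word_length :: "('a, 'b) monoid_scheme \<Rightarrow> 'a set \<Rightarrow> 'a \<Rightarrow> nat" where
  "word_length G S g =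
     (LEAST r. \<exists>w. length w = r \<and> set w \<subseteq> S \<union> (\<lambda>s. inv\<^bsub>G\<^esub> s) ` S \<and>
                   foldr (\<otimes>\<^bsub>G\<^esub>) w \<one>\<^bsub>G\<^esub> = g)"

definition conj_class :: "('a, 'b) monoid_scheme \<Rightarrow> 'a \<Rightarrow> 'a set" where
  "conj_class G g = {h \<otimes>\<^bsub>G\<^esub> g \<otimes>\<^bsub>G\<^esub> inv\<^bsub>G\<^esub> h | h. h \<in> carrier G}"

definition conj_classes :: "('a, 'b) monoid_scheme \<Rightarrow> 'a set set" where
  "conj_classes G = conj_class G ` carrier G"

definition conj_length :: "('a, 'b) monoid_scheme \<Rightarrow> 'a set \<Rightarrow> 'a \<Rightarrow> nat" where
  "conj_length G S g = Min (word_length G S ` conj_class G g)"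

definition growth_poly :: "('a, 'b) monoid_scheme \<Rightarrow> 'a set \<Rightarrow> int poly" where
  "growth_poly G S = (\<Sum>g\<in>carrier G. monom 1 (word_length G S g))"

text \<open>One representative is chosen in each class; by \<open>conj_growth_poly_eq_reps\<close> below, any
  other system of representatives gives the same polynomial.\<close>

definition conj_growth_poly :: "('a, 'b) monoid_scheme \<Rightarrow> 'a set \<Rightarrow> int poly" where
  "conj_growth_poly G S = (\<Sum>c\<in>conj_classes G. monom 1 (conj_length G S (SOME g. g \<in> c)))"

lemma (in group) conj_class_self:
  assumes "g \<in> carrier G" shows "g \<in> conj_class G g"
  unfolding conj_class_def using assms by (auto intro!: exI[of _ \<one>])

lemma (in group) conj_class_subset:
  assumes "g \<in> carrier G" "x \<in> conj_class G g" shows "conj_class G x \<subseteq> conj_class G g"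
proof
  fix y assume "y \<in> conj_class G x"
  then obtain k where k: "k \<in> carrier G" "y = k \<otimes> x \<otimes> inv k"
    unfolding conj_class_def by blast
  obtain h where h: "h \<in> carrier G" "x = h \<otimes> g \<otimes> inv h"
    using assms(2) unfolding conj_class_def by blast
  have "y = (k \<otimes> h) \<otimes> g \<otimes> inv (k \<otimes> h)"
    using k h assms(1) by (simp add: m_assoc inv_mult_group)
  thus "y \<in> conj_class G g"
    unfolding conj_class_def using k h by blast
qed

lemma (in group) conj_class_eq:
  assumes g: "g \<in> carrier G" and x: "x \<in> conj_class G g"
  shows "x \<in> carrier G" and "conj_class G x = conj_class G g"
proof -
  obtain h where h: "h \<in> carrier G" "x = h \<otimes> g \<otimes> inv h"
    using x unfolding conj_class_def by blast
  show xc: "x \<in> carrier G" using h g by simp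
  have "inv h \<otimes> x \<otimes> inv (inv h) = (inv h \<otimes> h) \<otimes> g \<otimes> (inv h \<otimes> h)"
    unfolding h(2) using h(1) g by (simp only: m_assoc inv_inv m_closed inv_closed)
  also have "\<dots> = g" using h(1) g by simp
  finally have "g \<in> conj_class G x"
    unfolding conj_class_def using h(1) by (auto intro!: exI[of _ "inv h"])
  thus "conj_class G x = conj_class G g"
    using conj_class_subset[OF g x] conj_class_subset[OF xc] by blast
qed

lemma (in group) conj_growth_poly_eq_reps:
  assumes R: "R \<subseteq> carrier G" and reps: "\<And>c. c \<in> conj_classes G \<Longrightarrow> \<exists>!r. r \<in> R \<and> r \<in> c"
  shows "conj_growth_poly G S = (\<Sum>r\<in>R. monom 1 (conj_length G S r))"
proof -
  have bij: "bij_betw (conj_class G) R (conj_classes G)"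
  proof (rule bij_betwI')
    fix x y assume xy: "x \<in> R" "y \<in> R"
    show "(conj_class G x = conj_class G y) = (x = y)"
      using reps[of "conj_class G x"] xy R conj_class_self[of x] conj_class_self[of y]
      unfolding conj_classes_def by blast
  next
    fix x assume "x \<in> R" thus "conj_class G x \<in> conj_classes G"
      using R unfolding conj_classes_def by blast
  next
    fix c assume c: "c \<in> conj_classes G"
    then obtain g where g: "g \<in> carrier G" "c = conj_class G g"
      unfolding conj_classes_def by blast
    obtain r where "r \<in> R" "r \<in> c" using reps[OF c] by blast
    thus "\<exists>x\<in>R. c = conj_class G x" using conj_class_eq(2)[of g r] g by auto
  qed
  have "conj_length G S (SOME g. g \<in> conj_class G r) = conj_length G S r" if "r \<in> R" for r
  proof -
    have rc: "r \<in> carrier G" using that R by blast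
    have "(SOME g. g \<in> conj_class G r) \<in> conj_class G r"
      using conj_class_self[OF rc] by (rule someI)
    thus ?thesis unfolding conj_length_def using conj_class_eq(2)[OF rc] by simp
  qed
  thus ?thesis
    unfolding conj_growth_poly_def by (simp flip: sum.reindex_bij_betw[OF bij])
qed


section \<open>The symmetric group of $\{0, \dots, n-1\}$ and its star transpositions\<close>

definition Sym :: "nat \<Rightarrow> (nat \<Rightarrow> nat) monoid" where
  "Sym n = \<lparr>carrier = {p. p permutes {0..<n}}, monoid.mult = (\<circ>), one = id\<rparr>"

definition star_transpositions :: "nat \<Rightarrow> (nat \<Rightarrow> nat) set" where
  "star_transpositions n = {Transposition.transpose 0 i | i. 1 \<le> i \<and> i \<le> n - 1}"

lemma group_Sym: "group (Sym n)"
proof (rule groupI)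
  fix p assume "p \<in> carrier (Sym n)"
  hence p: "p permutes {0..<n}" by (simp add: Sym_def)
  show "\<exists>q\<in>carrier (Sym n). q \<otimes>\<^bsub>Sym n\<^esub> p = \<one>\<^bsub>Sym n\<^esub>"
    using permutes_inv[OF p] permutes_inv_o(2)[OF p] by (auto simp: Sym_def)
qed (auto simp: Sym_def permutes_compose permutes_id comp_assoc)

lemma finite_Sym: "finite (carrier (Sym n))"
  by (simp add: Sym_def finite_permutations)

lemma generate_star_transpositions:
  "generate (Sym n) (star_transpositions n) = carrier (Sym n)"
proof -
  interpret group "Sym n" by (rule group_Sym)
  let ?H = "generate (Sym n) (star_transpositions n)"
  have sub: "star_transpositions n \<subseteq> carrier (Sym n)"
  proof
    fix p assume "p \<in> star_transpositions n"
    then obtain i where "p = Transposition.transpose 0 i" "1 \<le> i" "i \<le> n - 1"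
      unfolding star_transpositions_def by blast
    thus "p \<in> carrier (Sym n)" by (auto simp: Sym_def intro!: permutes_swap_id)
  qed
  have mult: "p \<circ> q \<in> ?H" if "p \<in> ?H" "q \<in> ?H" for p q
    using generate.eng[OF that] by (simp add: Sym_def)
  have id: "id \<in> ?H"
    using generate.one[of "Sym n" "star_transpositions n"] by (simp add: Sym_def)
  have t0: "Transposition.transpose 0 a \<in> ?H" if "a < n" for a
  proof (cases "a = 0")
    case True thus ?thesis using id by simp
  next
    case False thus ?thesis using that
      by (intro generate.incl) (auto simp: star_transpositions_def)
  qed
  have t: "Transposition.transpose a b \<in> ?H" if "a < n" "b < n" for a b
  proof -
    consider "a = b" | "a = 0" | "b = 0" | "a \<noteq> b" "a \<noteq> 0" "b \<noteq> 0" by blast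
    thus ?thesis
    proof cases
      case 1 thus ?thesis using id by simp
    next
      case 2 thus ?thesis using t0[OF that(2)] by simp
    next
      case 3 thus ?thesis using t0[OF that(1)] by (simp add: transpose_commute)
    next
      case 4
      have "Transposition.transpose a b =
        Transposition.transpose 0 a \<circ> (Transposition.transpose 0 b \<circ> Transposition.transpose 0 a)"
        using 4 by (auto simp: fun_eq_iff Transposition.transpose_def)
      thus ?thesis using t0 mult that by simp
    qed
  qed
  have "p \<in> ?H" if "p permutes {0..<n}" for p
    using that finite_atLeastLessThan
  proof (induction rule: permutes_induct)
    case id show ?case by (rule \<open>id \<in> ?H\<close>)
  next
    case (swap a b p) thus ?case by (intro mult t) simp_all
  qed
  thus ?thesis using generate_incl[OF sub] by (auto simp: Sym_def)
qed


section \<open>Derangements by number of cycles, partitions by number of parts\<close>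

text \<open>As \<open>css\<close> lists \<open>k\<close> nonempty lists, \<open>distinct (concat css)\<close> says that each of them is
  free of repetitions and that they are pairwise disjoint.\<close>

definition disjoint_cycle_product :: "nat \<Rightarrow> (nat \<Rightarrow> nat) \<Rightarrow> bool" where
  "disjoint_cycle_product k p \<longleftrightarrow>
     (\<exists>css. length css = k \<and> (\<forall>cs\<in>set css. 2 \<le> length cs) \<and> distinct (concat css) \<and>
            p = foldr (\<circ>) (map cycle_of_list css) id)"

definition num_derangements :: "nat \<Rightarrow> nat \<Rightarrow> nat" where
  "num_derangements k m =
     card {p. p permutes {1..m} \<and> (\<forall>x\<in>{1..m}. p x \<noteq> x) \<and> disjoint_cycle_product k p}"

text \<open>A conjugacy class of \<open>Sym n\<close> with \<open>k\<close> nontrivial cycles, of total length \<open>m \<le> n\<close>,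
  corresponds to the partition of \<open>j = m - k\<close> whose \<open>k\<close> parts are the cycle lengths minus one.
  Hence \<open>j\<close> ranges over \<open>{k..n - k}\<close> in the conjugacy growth polynomial.\<close>

definition num_partitions :: "nat \<Rightarrow> nat \<Rightarrow> nat" where
  "num_partitions k j = card {M :: nat multiset. size M = k \<and> sum_mset M = j \<and> 0 \<notin># M}"

end

theory Submission
  imports Defs
begin

text \<open>Fix a permutation \<open>p\<close> moving \<open>m\<close> points, in \<open>k\<close> nontrivial cycles. A cycle through \<open>0\<close> with
  \<open>l\<close> points is a product of \<open>l - 1\<close> star transpositions and any other one is a product of \<open>l + 1\<close>.
  This is optimal: every nonzero moved point occurs as a letter of a word for \<open>p\<close>, and every cycle
  avoiding \<open>0\<close> contains a point that occurs twice. Hence \<open>p\<close> has length \<open>m + k\<close> if it fixes \<open>0\<close> and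
  \<open>m + k - 2\<close> otherwise. Sorting permutations by the set of points they move gives the growth
  polynomial. A conjugacy class is given by the multiset of its cycle lengths, and each nontrivial
  class contains a permutation moving \<open>0\<close>, so it has conjugacy length \<open>m + k - 2\<close>.\<close>

section \<open>Factorization into disjoint cycles and cycle type\<close>

definition cycles_prod :: "'a list list \<Rightarrow> 'a \<Rightarrow> 'a" where
  "cycles_prod css = foldr (\<circ>) (map cycle_of_list css) id"

lemma cycles_prod_Nil [simp]: "cycles_prod [] = id"
  by (simp add: cycles_prod_def)

lemma cycles_prod_Cons [simp]: "cycles_prod (cs # css) = cycle_of_list cs \<circ> cycles_prod css"
  by (simp add: cycles_prod_def)

text \<open>The witness of \<open>disjoint_cycle_product\<close> made explicit: support, cycle
  lengths and word length are all read off from this list. Entries have at least two points, so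
  fixed points are never listed.\<close>

definition cycle_factorization :: "'a list list \<Rightarrow> ('a \<Rightarrow> 'a) \<Rightarrow> bool" where
  "cycle_factorization css p \<longleftrightarrow>
     (\<forall>cs\<in>set css. 2 \<le> length cs) \<and> distinct (concat css) \<and>
     p = cycles_prod css"

lemma disjoint_cycle_product_iff:
  "disjoint_cycle_product k p \<longleftrightarrow> (\<exists>css. cycle_factorization css p \<and> length css = k)"
  unfolding disjoint_cycle_product_def cycle_factorization_def cycles_prod_def by auto

lemma cycle_factorization_Nil: "cycle_factorization [] p \<longleftrightarrow> p = id"
  by (simp add: cycle_factorization_def)

lemma cycles_prod_outside:
  "x \<notin> set (concat css) \<Longrightarrow> cycles_prod css x = x"
  by (induction css) (auto simp: id_outside_supp)

lemma cycle_factorization_outside: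
  "cycle_factorization css p \<Longrightarrow> x \<notin> set (concat css) \<Longrightarrow> p x = x"
  by (auto simp: cycle_factorization_def cycles_prod_outside)

text \<open>By disjointness no other entry touches \<open>x\<close>: the cycles applied before leave
  \<open>x\<close> alone, and its image stays in \<open>cs\<close>, out of reach of the cycles
  applied afterwards.\<close>

lemma cycles_prod_inside:
  assumes "distinct (concat css)" "cs \<in> set css" "x \<in> set cs"
  shows "cycles_prod css x = cycle_of_list cs x"
  using assms
proof (induction css)
  case (Cons c css)
  show ?case
  proof (cases "x \<in> set c")
    case True
    then have "x \<notin> set (concat css)" using Cons.prems(1) by auto
    moreover have "cs = c" using Cons.prems True by auto
    ultimately show ?thesis using cycles_prod_outside[of x css] by simp
  next
    case False
    then have cs: "cs \<in> set css" using Cons.prems by auto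
    have "distinct cs" using cs Cons.prems(1) by (auto simp: distinct_concat_iff)
    then have "cycle_of_list cs x \<in> set cs"
      using cycle_is_surj[of cs] Cons.prems(3) by blast
    then have "cycle_of_list cs x \<notin> set c" using cs Cons.prems(1) by auto
    then show ?thesis using Cons.IH[OF _ cs] Cons.prems by (simp add: id_outside_supp)
  qed
qed simp

lemma cycle_factorization_inside:
  assumes "cycle_factorization css p" "cs \<in> set css" "x \<in> set cs"
  shows "p x = cycle_of_list cs x"
  using assms cycles_prod_inside[of css cs x] by (simp add: cycle_factorization_def)

lemma cycle_factorization_distinct:
  "cycle_factorization css p \<Longrightarrow> cs \<in> set css \<Longrightarrow> distinct cs"
  by (simp add: cycle_factorization_def distinct_concat_iff)

lemma cycle_factorization_length:
  "cycle_factorization css p \<Longrightarrow> cs \<in> set css \<Longrightarrow> 2 \<le> length cs"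
  by (auto simp: cycle_factorization_def)

lemma cycle_of_list_funpow_nth:
  assumes "distinct cs" "i < length cs"
  shows "(cycle_of_list cs ^^ n) (cs ! i) = cs ! ((n + i) mod length cs)"
proof -
  have "map (cycle_of_list cs ^^ n) cs ! i = rotate n cs ! i"
    by (simp only: cyclic_rotation[OF assms(1)])
  then show ?thesis using assms(2) by (simp add: nth_rotate)
qed

lemma cycle_factorization_funpow:
  assumes "cycle_factorization css p" "cs \<in> set css" "x \<in> set cs"
  shows "(p ^^ n) x = (cycle_of_list cs ^^ n) x" "(p ^^ n) x \<in> set cs"
proof -
  have surj: "cycle_of_list cs ` set cs = set cs"
    using cycle_is_surj cycle_factorization_distinct[OF assms(1,2)] .
  have "(p ^^ n) x = (cycle_of_list cs ^^ n) x \<and> (p ^^ n) x \<in> set cs"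
  proof (induction n)
    case (Suc n)
    then show ?case using cycle_factorization_inside[OF assms(1,2), of "(p ^^ n) x"] surj
      by auto
  qed (simp add: assms)
  then show "(p ^^ n) x = (cycle_of_list cs ^^ n) x" "(p ^^ n) x \<in> set cs" by auto
qed

text \<open>Makes the entries intrinsic: as sets they are orbits of \<open>p\<close>, whatever
  factorization was chosen.\<close>

lemma cycle_factorization_orbit:
  assumes "cycle_factorization css p" "cs \<in> set css" "x \<in> set cs"
  shows "range (\<lambda>n. (p ^^ n) x) = set cs"
proof
  show "range (\<lambda>n. (p ^^ n) x) \<subseteq> set cs"
    using cycle_factorization_funpow(2)[OF assms] by auto
  show "set cs \<subseteq> range (\<lambda>n. (p ^^ n) x)"
  proof
    fix y assume "y \<in> set cs"
    then obtain j where j: "j < length cs" "y = cs ! j" by (auto simp: in_set_conv_nth)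
    obtain i where i: "i < length cs" "x = cs ! i" using assms(3) by (auto simp: in_set_conv_nth)
    \<comment> \<open>From index \<open>i\<close> run to the end of the list, then \<open>j\<close>
      steps further; this avoids \<open>j - i\<close>, which may be negative.\<close>
    have "(p ^^ (length cs - i + j)) x = cs ! ((length cs - i + j + i) mod length cs)"
      using cycle_factorization_funpow(1)[OF assms]
        cycle_of_list_funpow_nth[OF cycle_factorization_distinct[OF assms(1,2)] i(1)] i(2) by simp
    also have "(length cs - i + j + i) mod length cs = j" using i j by simp
    finally show "y \<in> range (\<lambda>n. (p ^^ n) x)" using j by (metis rangeI)
  qed
qed

lemma cycle_factorization_moves:
  assumes "cycle_factorization css p"
  shows "p x \<noteq> x \<longleftrightarrow> x \<in> set (concat css)"
proof
  assume "x \<in> set (concat css)"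
  then obtain cs where cs: "cs \<in> set css" "x \<in> set cs" by auto
  note d = cycle_factorization_distinct[OF assms cs(1)]
  note l = cycle_factorization_length[OF assms cs(1)]
  obtain i where i: "i < length cs" "x = cs ! i" using cs(2) by (auto simp: in_set_conv_nth)
  have "p x = cs ! ((1 + i) mod length cs)"
    using cycle_factorization_inside[OF assms cs] cycle_of_list_funpow_nth[OF d i(1), of 1] i(2)
    by simp
  \<comment> \<open>Length at least 2 keeps the cyclic successor of an index apart from the index
    itself.\<close>
  moreover have "(1 + i) mod length cs \<noteq> i"
    using l i(1) by (cases "Suc i = length cs") auto
  moreover have "(1 + i) mod length cs < length cs" using l by (intro mod_less_divisor) linarith
  ultimately show "p x \<noteq> x" using d i by (simp add: nth_eq_iff_index_eq)
qed (use cycle_factorization_outside[OF assms] in blast)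

text \<open>Built from orbits of \<open>p\<close> itself, so no factorization has to be chosen.
  Taking the set of orbits first counts each cycle once, while \<open>image_mset\<close> keeps the
  multiplicity of equal lengths; fixed points contribute nothing.\<close>

definition cycle_type :: "('a \<Rightarrow> 'a) \<Rightarrow> nat multiset" where
  "cycle_type p = image_mset card (mset_set ((\<lambda>x. range (\<lambda>n. (p ^^ n) x)) ` {x. p x \<noteq> x}))"

lemma cycle_type_eq:
  assumes "cycle_factorization css p"
  shows "cycle_type p = mset (map length css)"
proof -
  note D = cycle_factorization_distinct[OF assms]
  note L = cycle_factorization_length[OF assms]
  have "(\<lambda>x. range (\<lambda>n. (p ^^ n) x)) ` {x. p x \<noteq> x} = set ` set css"
  proof (intro equalityI subsetI)
    fix A assume "A \<in> (\<lambda>x. range (\<lambda>n. (p ^^ n) x)) ` {x. p x \<noteq> x}"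
    then obtain x where "p x \<noteq> x" "A = range (\<lambda>n. (p ^^ n) x)" by blast
    then show "A \<in> set ` set css"
      using cycle_factorization_moves[OF assms] cycle_factorization_orbit[OF assms] by auto
  next
    fix A assume "A \<in> set ` set css"
    then obtain cs where cs: "cs \<in> set css" "A = set cs" by auto
    then have "cs \<noteq> []" using L[OF cs(1)] by auto
    then obtain x where "x \<in> set cs" using list.set_sel(1) by metis
    then show "A \<in> (\<lambda>x. range (\<lambda>n. (p ^^ n) x)) ` {x. p x \<noteq> x}"
      using cs cycle_factorization_moves[OF assms] cycle_factorization_orbit[OF assms cs(1)] by force
  qed
  \<comment> \<open>\<open>mset_set\<close> would merge equal supports; disjoint entries have
    different supports because they are nonempty.\<close>
  moreover have "distinct (map set css)"
  proof -
    have "distinct (concat css)" "\<forall>cs\<in>set css. 2 \<le> length cs"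
      using assms by (auto simp: cycle_factorization_def)
    then show ?thesis
    proof (induction css)
      case (Cons cs css)
      then have "set cs \<noteq> {}" "\<forall>c\<in>set css. set cs \<inter> set c = {}" by auto
      then have "set cs \<notin> set ` set css" by (metis imageE Int_absorb)
      with Cons show ?case by simp
    qed simp
  qed
  ultimately have "cycle_type p = image_mset card (mset (map set css))"
    unfolding cycle_type_def using mset_set_set[of "map set css"] by simp
  also have "\<dots> = mset (map length css)"
    using D by (auto simp: distinct_card multiset.map_comp simp flip: mset_map intro!: arg_cong[of _ _ mset])
  finally show ?thesis .
qed

section \<open>Existence of factorizations and their behaviour under conjugation\<close>

text \<open>\<open>cycle_decomp\<close> also accepts lists with fewer than two points; their cycles
  are the identity and are dropped here.\<close>

lemma cycle_decomp_factorization: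
  assumes "cycle_decomp S p"
  shows "\<exists>css. cycle_factorization css p \<and> set (concat css) \<subseteq> S"
  using assms
proof induction
  case empty
  show ?case using cycle_factorization_Nil by (metis empty_subsetI concat.simps(1) list.set(1))
next
  case (comp I p cs)
  then obtain css where css: "cycle_factorization css p" "set (concat css) \<subseteq> I" by blast
  show ?case
  proof (cases "2 \<le> length cs")
    case True
    moreover have "set cs \<inter> set (concat css) = {}" using comp.hyps(3) css(2) by blast
    ultimately have "cycle_factorization (cs # css) (cycle_of_list cs \<circ> p)"
      using comp.hyps(2) css(1) by (simp add: cycle_factorization_def)
    moreover have "set (concat (cs # css)) \<subseteq> set cs \<union> I" using css(2) by auto
    ultimately show ?thesis by blast
  next
    case False
    then have "cycle_of_list cs = id" by (cases cs rule: cycle_of_list.cases) auto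
    then show ?thesis using css by auto
  qed
qed

lemma cycle_factorization_exists:
  assumes "p permutes S" "finite S"
  obtains css where "cycle_factorization css p" "set (concat css) \<subseteq> S"
  using cycle_decomp_factorization[OF cycle_decomposition[OF assms]] by blast

lemma cycle_factorization_permutes:
  assumes "cycle_factorization css p" "set (concat css) \<subseteq> S"
  shows "p permutes S"
proof -
  have "cycles_prod css permutes set (concat css)" for css :: "'a list list"
  proof (induction css)
    case (Cons cs css)
    have "cycle_of_list cs permutes set (concat (cs # css))"
      by (rule permutes_subset[OF cycle_permutes]) simp
    moreover have "cycles_prod css permutes set (concat (cs # css))"
      by (rule permutes_subset[OF Cons.IH]) simp
    ultimately show ?case unfolding cycles_prod_Cons by (intro permutes_compose)
  qed (simp add: id_def)
  then show ?thesis using assms permutes_subset unfolding cycle_factorization_def by blast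
qed

text \<open>Conjugation by \<open>h\<close> relabels the points of each cycle, and it distributes
  over the product because \<open>inv_into UNIV h\<close> cancels \<open>h\<close> between the
  factors.\<close>

lemma cycle_factorization_conj:
  assumes "cycle_factorization css p" "bij h"
  shows "cycle_factorization (map (map h) css) (h \<circ> p \<circ> inv_into UNIV h)"
proof -
  have inj: "inj h" using assms(2) by (rule bij_is_inj)
  have "h \<circ> cycles_prod css \<circ> inv_into UNIV h =
        cycles_prod (map (map h) css)"
    if "distinct (concat css)"
    using that
  proof (induction css)
    case Nil
    then show ?case using surj_iff[of h] bij_is_surj[OF assms(2)] by simp
  next
    case (Cons cs css)
    have "h \<circ> cycles_prod (cs # css) \<circ> inv_into UNIV h =
      (h \<circ> cycle_of_list cs \<circ> inv_into UNIV h) \<circ> (h \<circ> cycles_prod css \<circ> inv_into UNIV h)"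
      using inj by (simp add: fun_eq_iff)
    also have "h \<circ> cycle_of_list cs \<circ> inv_into UNIV h = cycle_of_list (map h cs)"
      using conjugation_of_cycle[of cs h] assms(2) Cons.prems by simp
    also have "h \<circ> cycles_prod css \<circ> inv_into UNIV h = cycles_prod (map (map h) css)"
      using Cons.IH Cons.prems by (metis concat.simps(2) distinct_append)
    finally show ?case by simp
  qed
  moreover have "distinct (concat (map (map h) css)) \<longleftrightarrow> distinct (concat css)"
    unfolding map_concat[symmetric] distinct_map using inj inj_on_subset by blast
  moreover have "\<forall>cs\<in>set (map (map h) css). 2 \<le> length cs"
    using cycle_factorization_length[OF assms(1)] by auto
  ultimately show ?thesis using assms(1) unfolding cycle_factorization_def by metis
qed

section \<open>Extending partial bijections to permutations\<close>

text \<open>The complements of \<open>A\<close> and \<open>B\<close> in the finite set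
  \<open>S\<close> have equal size, so any bijection between them fills the gap; outside
  \<open>S\<close> the identity is used.\<close>

lemma extend_bij_betw:
  assumes "finite S" "bij_betw f A B" "A \<subseteq> S" "B \<subseteq> S"
  obtains h where "h permutes S" "\<And>x. x \<in> A \<Longrightarrow> h x = f x"
proof -
  have "finite A" "finite B" using assms finite_subset by auto
  then have "card (S - A) = card (S - B)"
    using assms bij_betw_same_card[OF assms(2)] by (simp add: card_Diff_subset)
  then obtain g where g: "bij_betw g (S - A) (S - B)"
    using assms(1) by (metis bij_betw_iff_card finite_Diff)
  define h where "h x = (if x \<in> A then f x else if x \<in> S then g x else x)" for x
  have "bij_betw h A B" using assms(2) by (subst bij_betw_cong[of _ _ f]) (auto simp: h_def)
  moreover have "bij_betw h (S - A) (S - B)"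
    using g by (subst bij_betw_cong[of _ _ g]) (auto simp: h_def)
  ultimately have "bij_betw h (A \<union> (S - A)) (B \<union> (S - B))" by (rule bij_betw_combine) auto
  moreover have "A \<union> (S - A) = S" "B \<union> (S - B) = S" using assms by auto
  ultimately have "h permutes S"
    using assms(3) by (intro bij_imp_permutes) (auto simp: h_def)
  then show ?thesis using that[of h] by (auto simp: h_def)
qed

lemma extend_map:
  assumes "finite S" "distinct xs" "distinct ys" "length xs = length ys"
    "set xs \<subseteq> S" "set ys \<subseteq> S"
  obtains h where "h permutes S" "map h xs = ys"
proof -
  define f where "f = the \<circ> map_of (zip xs ys)"
  have f: "map f xs = ys"
    using assms by (intro nth_equalityI) (auto simp: f_def map_of_zip_nth)
  then have "bij_betw f (set xs) (set ys)"
    using assms(2,3) by (metis bij_betw_def distinct_map list.set_map)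
  then obtain h where h: "h permutes S" "\<And>x. x \<in> set xs \<Longrightarrow> h x = f x"
    using extend_bij_betw[OF assms(1) _ assms(5,6)] by blast
  have "map h xs = map f xs" using h(2) by (intro map_cong) auto
  then have "map h xs = ys" using f by simp
  with h(1) show ?thesis by (rule that)
qed


section \<open>Word length with respect to star transpositions\<close>

text \<open>Words are lists of indices, \<open>i\<close> standing for the transposition of
  \<open>0\<close> and \<open>i\<close>. The rightmost letter acts first.\<close>

definition star_prod :: "nat list \<Rightarrow> nat \<Rightarrow> nat" where
  "star_prod is = foldr (\<circ>) (map (Transposition.transpose 0) is) id"

lemma star_prod_Nil [simp]: "star_prod [] = id"
  by (simp add: star_prod_def)

lemma star_prod_Cons [simp]: "star_prod (i # is) = Transposition.transpose 0 i \<circ> star_prod is"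
  by (simp add: star_prod_def)

lemma star_prod_append: "star_prod (is @ js) = star_prod is \<circ> star_prod js"
  by (induction "is") (simp_all add: comp_assoc)

lemma inj_star_prod: "inj (star_prod is)"
proof (induction "is")
  case (Cons i "is")
  have "inj (Transposition.transpose 0 i)" by simp
  then show ?case using Cons by (simp only: star_prod_Cons inj_compose)
qed simp

lemma star_prod_outside: "x \<noteq> 0 \<Longrightarrow> x \<notin> set is \<Longrightarrow> star_prod is x = x"
  by (induction "is") auto

text \<open>Conjugation by \<open>?t\<close> turns the cycle \<open>a # cs\<close> into
  \<open>0 # cs\<close>, to which the induction hypothesis applies. Since the cycle of
  \<open>0 # a # cs\<close> is \<open>?t\<close> composed with that of \<open>a # cs\<close>, it
  equals this conjugate followed on the right by \<open>?t\<close>, which appends the letter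
  \<open>a\<close>.\<close>

lemma cycle_from_0_eq_star_prod:
  "distinct (0 # cs) \<Longrightarrow> cycle_of_list (0 # cs) = star_prod (rev cs)"
proof (induction cs)
  case (Cons a cs)
  let ?t = "Transposition.transpose 0 a"
  have "map ?t cs = cs" using Cons.prems
    by (intro map_idI) (auto simp: transpose_eq_iff)
  then have m: "map ?t (a # cs) = 0 # cs" by simp
  have d: "distinct (a # cs)" using Cons.prems by simp
  have inv: "inv_into UNIV ?t = ?t" by (rule inv_unique_comp) simp_all
  have "?t \<circ> cycle_of_list (a # cs) \<circ> ?t = star_prod (rev cs)"
    using conjugation_of_cycle[OF d, of ?t] Cons unfolding m inv by simp
  then have "(?t \<circ> cycle_of_list (a # cs) \<circ> ?t) \<circ> ?t = star_prod (rev cs) \<circ> ?t" by simp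
  then show ?case by (simp add: comp_assoc star_prod_append)
qed simp

text \<open>The number of letters that an optimal word spends on the nontrivial cycle
  \<open>cs\<close>.\<close>

definition cycle_weight :: "nat list \<Rightarrow> nat" where
  "cycle_weight cs = (if 0 \<in> set cs then length cs - 1 else length cs + 1)"

lemma cycle_eq_star_prod:
  assumes "distinct cs" "cs \<noteq> []"
  obtains "is" where "cycle_of_list cs = star_prod is" "length is = cycle_weight cs"
    "set is \<subseteq> set cs - {0}"
proof (cases "0 \<in> set cs")
  case True
  then obtain xs ys where cs: "cs = xs @ 0 # ys" by (auto dest: split_list)
  \<comment> \<open>A cycle depends only on the cyclic order of its points, so \<open>0\<close> may
    be rotated to the front.\<close>
  have "cycle_of_list cs = cycle_of_list (rotate (length xs) cs)"
    using assms(1) by (rule cycle_of_list_rotate_independent)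
  also have "rotate (length xs) cs = 0 # ys @ xs" by (simp add: cs rotate_append)
  also have "cycle_of_list \<dots> = star_prod (rev (ys @ xs))"
    using assms(1) by (intro cycle_from_0_eq_star_prod) (auto simp: cs)
  finally have "cycle_of_list cs = star_prod (rev (ys @ xs))" .
  moreover have "length (rev (ys @ xs)) = cycle_weight cs" by (simp add: cs cycle_weight_def)
  moreover have "set (rev (ys @ xs)) \<subseteq> set cs - {0}" using assms(1) by (auto simp: cs)
  ultimately show ?thesis by (rule that)
next
  case False
  obtain a as where cs: "cs = a # as" using assms(2) by (cases cs) auto
  let ?t = "Transposition.transpose 0 a"
  \<comment> \<open>Insert \<open>0\<close> into the cycle and remove it again by the involution
    \<open>?t\<close>; thus \<open>a\<close> becomes the letter that occurs twice.\<close>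
  have "cycle_of_list (0 # cs) = star_prod (rev cs)"
    using assms(1) False by (intro cycle_from_0_eq_star_prod) auto
  then have "?t \<circ> (?t \<circ> cycle_of_list cs) = ?t \<circ> star_prod (rev cs)" by (simp add: cs)
  then have "cycle_of_list cs = star_prod (a # rev cs)" by (simp flip: comp_assoc)
  moreover have "length (a # rev cs) = cycle_weight cs" using False by (simp add: cycle_weight_def)
  moreover have "set (a # rev cs) \<subseteq> set cs - {0}" using False by (auto simp: cs)
  ultimately show ?thesis by (rule that)
qed

lemma cycles_prod_eq_star_prod:
  assumes "distinct (concat css)" "\<forall>cs\<in>set css. cs \<noteq> []"
  shows "\<exists>is. cycles_prod css = star_prod is \<and> length is = sum_list (map cycle_weight css) \<and>
    set is \<subseteq> set (concat css) - {0}"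
  using assms
proof (induction css)
  case Nil
  show ?case by (rule exI[of _ "[]"]) simp
next
  case (Cons cs css)
  then obtain js where js: "cycles_prod css = star_prod js"
    "length js = sum_list (map cycle_weight css)" "set js \<subseteq> set (concat css) - {0}"
    by auto
  obtain "is" where "is": "cycle_of_list cs = star_prod is" "length is = cycle_weight cs"
    "set is \<subseteq> set cs - {0}"
    using cycle_eq_star_prod[of cs] Cons.prems by auto
  have "cycles_prod (cs # css) = star_prod (is @ js)"
    by (simp only: cycles_prod_Cons star_prod_append js "is")
  moreover have "set (is @ js) \<subseteq> set (concat (cs # css)) - {0}" using js(3) "is"(3) by auto
  ultimately show ?case using js(2) "is"(2) by (intro exI[of _ "is @ js"]) simp
qed

text \<open>If every point of a cycle avoiding \<open>0\<close> occurred only once in the word, consider the point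
  \<open>i\<close> that is applied first: the letters after it never touch \<open>i\<close> again, so the preimage of \<open>i\<close>
  must have been moved to position \<open>0\<close> by an earlier letter of the same cycle.\<close>

lemma repeated_letter:
  assumes cf: "cycle_factorization css (star_prod is)" and cs: "cs \<in> set css" and 0: "0 \<notin> set cs"
  shows "\<exists>i\<in>set cs. 2 \<le> count_list is i"
proof (rule ccontr)
  assume neg: "\<not> ?thesis"
  have moves: "star_prod is x \<noteq> x" if "x \<in> set cs" for x
    using cycle_factorization_moves[OF cf, of x] cs that by auto
  have in_word: "x \<in> set is" if "x \<in> set cs" for x
    using moves[OF that] star_prod_outside[of x "is"] that 0 by metis
  have "cs \<noteq> []" using cycle_factorization_length[OF cf cs] by auto
  then have "\<exists>i\<in>set is. i \<in> set cs" using in_word hd_in_set by blast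
  then obtain us i vs where w: "is = us @ i # vs" "i \<in> set cs" "\<forall>v\<in>set vs. v \<notin> set cs"
    by (rule split_list_last_propE)
  have "count_list is i < 2" using neg w(2) by (meson not_le_imp_less)
  then have "count_list us i = 0" using w(1) by simp
  then have "i \<notin> set us" by (simp add: count_list_0_iff)
  moreover have "i \<noteq> 0" using w(2) 0 by metis
  ultimately have us: "star_prod us i = i" using star_prod_outside by blast
  have "cycle_of_list cs ` set cs = set cs"
    using cycle_is_surj cycle_factorization_distinct[OF cf cs] .
  then obtain x where x: "x \<in> set cs" "star_prod is x = i"
    using w(2) cycle_factorization_inside[OF cf cs] by (metis imageE)
  have "x \<noteq> 0" "x \<notin> set vs" using x(1) 0 w(3) by metis+
  moreover have "x \<noteq> i" using moves[OF x(1)] x(2) by simp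
  \<comment> \<open>The letters in \<open>vs\<close> act first and fix \<open>x\<close>, and so does
    the letter \<open>i\<close>. Hence \<open>us\<close> sends both \<open>x\<close> and
    \<open>i\<close> to \<open>i\<close>, against injectivity.\<close>
  ultimately have "star_prod is x = star_prod us x"
    using star_prod_outside[of x vs] by (simp add: w(1) star_prod_append)
  then have "star_prod us x = star_prod us i" using x(2) us by simp
  then show False using inj_star_prod[of us] \<open>x \<noteq> i\<close> by (simp add: inj_eq)
qed

text \<open>The lower bound. Letters are counted cycle by cycle: each nonzero point of a cycle
  occurs at least once, and a cycle avoiding \<open>0\<close> has a point occurring twice. As the
  cycles are disjoint, the counts add up to at most the length of the word.\<close>

lemma sum_cycle_weight_le:
  assumes cf: "cycle_factorization css (star_prod is)"
  shows "sum_list (map cycle_weight css) \<le> length is"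
proof -
  have in_word: "1 \<le> count_list is x" if "x \<in> set (concat css)" "x \<noteq> 0" for x
    using cycle_factorization_moves[OF cf, of x] that star_prod_outside[of x "is"]
      count_list_0_iff[of "is" x] by (metis One_nat_def Suc_leI neq0_conv)
  have weight: "cycle_weight cs \<le> sum_list (map (count_list is) cs)" if cs: "cs \<in> set css" for cs
  proof -
    have d: "distinct cs" using cycle_factorization_distinct[OF cf cs] .
    have pos: "1 \<le> count_list is x" if "x \<in> set cs" "x \<noteq> 0" for x
      using in_word[of x] cs that by auto
    show ?thesis
    proof (cases "0 \<in> set cs")
      case True
      have "cycle_weight cs = card (set cs - {0})"
        using True d by (simp add: cycle_weight_def distinct_card)
      also have "\<dots> \<le> (\<Sum>x\<in>set cs - {0}. count_list is x)"
        using sum_mono[of "set cs - {0}" "\<lambda>_. 1" "count_list is"] pos by simp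
      also have "\<dots> \<le> (\<Sum>x\<in>set cs. count_list is x)" by (intro sum_mono2) auto
      finally show ?thesis using d by (simp add: sum_list_distinct_conv_sum_set)
    next
      case False
      obtain i where i: "i \<in> set cs" "2 \<le> count_list is i"
        using repeated_letter[OF cf cs False] by blast
      have "card (set cs - {i}) \<le> (\<Sum>x\<in>set cs - {i}. count_list is x)"
        using sum_mono[of "set cs - {i}" "\<lambda>_. 1" "count_list is"] pos False by (auto intro: ccontr)
      moreover have "(\<Sum>x\<in>set cs. count_list is x) =
          count_list is i + (\<Sum>x\<in>set cs - {i}. count_list is x)"
        using i by (simp add: sum.remove)
      moreover have "card (set cs - {i}) = length cs - 1" using i d by (simp add: distinct_card)
      ultimately show ?thesis
        using i d False by (simp add: cycle_weight_def sum_list_distinct_conv_sum_set)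
    qed
  qed
  have "sum_list (map cycle_weight css) \<le> (\<Sum>cs\<leftarrow>css. sum_list (map (count_list is) cs))"
    by (intro sum_list_mono weight)
  also have "\<dots> = sum_list (map (count_list is) (concat css))"
    by (induction css) simp_all
  also have "\<dots> = (\<Sum>x\<in>set (concat css). count_list is x)"
    using cf by (intro sum_list_distinct_conv_sum_set) (simp add: cycle_factorization_def)
  \<comment> \<open>The word may contain letters outside all cycles; the union makes the index set
    large enough for \<open>sum_count_set\<close>.\<close>
  also have "\<dots> \<le> (\<Sum>x\<in>set (concat css) \<union> set is. count_list is x)" by (intro sum_mono2) auto
  also have "\<dots> = length is" by (intro sum_count_set) auto
  finally show ?thesis .
qed

text \<open>At most one of the disjoint cycles contains \<open>0\<close>, so the saving of 2 occurs
  at most once. It is added on the left to avoid truncated subtraction.\<close>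

lemma sum_cycle_weight:
  assumes "distinct (concat css)" "\<forall>cs\<in>set css. cs \<noteq> []"
  shows "sum_list (map cycle_weight css) + (if 0 \<in> set (concat css) then 2 else 0) =
    length (concat css) + length css"
  using assms
proof (induction css)
  case (Cons cs css)
  have "cycle_weight cs + (if 0 \<in> set cs then 2 else 0) = length cs + 1"
    using Cons.prems by (cases cs) (auto simp: cycle_weight_def)
  with Cons show ?case by (auto split: if_splits)
qed simp

section \<open>From index words to word length in \<open>Sym n\<close>\<close>

text \<open>Rewrites the predicate under \<open>LEAST\<close> in \<open>word_length\<close> in terms
  of index lists. The generators are involutions, so their inverses add no letters.\<close>

lemma star_transpositions_words:
  assumes "n \<ge> 1"
  shows "(\<exists>w. length w = r \<and>
      set w \<subseteq> star_transpositions n \<union> (\<lambda>s. inv\<^bsub>Sym n\<^esub> s) ` star_transpositions n \<and>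
      foldr (\<otimes>\<^bsub>Sym n\<^esub>) w \<one>\<^bsub>Sym n\<^esub> = p) \<longleftrightarrow>
    (\<exists>is. length is = r \<and> set is \<subseteq> {1..n - 1} \<and> star_prod is = p)"
proof -
  interpret group "Sym n" by (rule group_Sym)
  have S: "star_transpositions n = Transposition.transpose 0 ` {1..n - 1}"
    by (auto simp: star_transpositions_def)
  have "inv\<^bsub>Sym n\<^esub> s = s" if s: "s \<in> star_transpositions n" for s
  proof -
    obtain i where i: "i \<in> {1..n - 1}" "s = Transposition.transpose 0 i"
      using s unfolding S by blast
    have "s permutes {0..<n}" using i assms by (auto intro!: permutes_swap_id)
    then show ?thesis using i by (intro inv_equality) (auto simp: Sym_def)
  qed
  then have "star_transpositions n \<union> (\<lambda>s. inv\<^bsub>Sym n\<^esub> s) ` star_transpositions n =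
      Transposition.transpose 0 ` {1..n - 1}" using S by auto
  moreover have "foldr (\<otimes>\<^bsub>Sym n\<^esub>) (map (Transposition.transpose 0) is) \<one>\<^bsub>Sym n\<^esub> = star_prod is" for "is"
    by (simp add: star_prod_def Sym_def)
  moreover have "set w \<subseteq> Transposition.transpose 0 ` A \<longleftrightarrow>
      (\<exists>is. w = map (Transposition.transpose 0) is \<and> set is \<subseteq> A)" for w and A :: "nat set"
  proof
    assume "set w \<subseteq> Transposition.transpose 0 ` A"
    then have "w \<in> map (Transposition.transpose 0) ` lists A"
      by (simp add: lists_image[symmetric] in_lists_conv_set subset_iff)
    then show "\<exists>is. w = map (Transposition.transpose 0) is \<and> set is \<subseteq> A"
      by (auto simp only: in_lists_conv_set subset_iff)
  next
    assume "\<exists>is. w = map (Transposition.transpose 0) is \<and> set is \<subseteq> A"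
    then show "set w \<subseteq> Transposition.transpose 0 ` A" by (metis image_mono list.set_map)
  qed
  ultimately show ?thesis by (metis length_map)
qed

lemma word_length_cycle_factorization:
  assumes "n \<ge> 1" "cycle_factorization css p" "set (concat css) \<subseteq> {0..<n}"
  shows "word_length (Sym n) (star_transpositions n) p = sum_list (map cycle_weight css)"
  unfolding word_length_def star_transpositions_words[OF assms(1)]
proof (rule Least_equality)
  have "\<forall>cs\<in>set css. cs \<noteq> []" using assms(2) by (auto simp: cycle_factorization_def)
  then obtain "is" where "is": "cycles_prod css = star_prod is"
    "length is = sum_list (map cycle_weight css)" "set is \<subseteq> set (concat css) - {0}"
    using cycles_prod_eq_star_prod[of css] assms(2) unfolding cycle_factorization_def by blast
  \<comment> \<open>The word is admissible: its letters are nonzero points of the cycles, hence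
    indices of generators.\<close>
  have "set is \<subseteq> {1..n - 1}"
  proof
    fix x assume "x \<in> set is"
    with "is"(3) have "x \<in> set (concat css) - {0}" by (rule subsetD)
    then have "x \<in> {0..<n}" "x \<noteq> 0" using subsetD[OF assms(3), of x] by simp_all
    then show "x \<in> {1..n - 1}" by simp
  qed
  with "is" show "\<exists>is. length is = sum_list (map cycle_weight css) \<and> set is \<subseteq> {1..n - 1} \<and>
      star_prod is = p"
    using assms(2) unfolding cycle_factorization_def by metis
next
  fix r assume "\<exists>is. length is = r \<and> set is \<subseteq> {1..n - 1} \<and> star_prod is = p"
  then show "sum_list (map cycle_weight css) \<le> r" using sum_cycle_weight_le assms(2) by blast
qed

text \<open>The length formula in terms of \<open>p\<close> alone, ready for summation without
  choosing factorizations. By \<open>sum_cycle_weight\<close> the subtraction never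
  truncates.\<close>

lemma word_length_star_transpositions:
  assumes "n \<ge> 1" "p permutes {0..<n}"
  shows "word_length (Sym n) (star_transpositions n) p =
    card {x. p x \<noteq> x} + size (cycle_type p) - (if p 0 \<noteq> 0 then 2 else 0)"
proof -
  obtain css where css: "cycle_factorization css p" "set (concat css) \<subseteq> {0..<n}"
    using cycle_factorization_exists[OF assms(2)] by auto
  have d: "distinct (concat css)" "\<forall>cs\<in>set css. cs \<noteq> []"
    using css(1) by (auto simp: cycle_factorization_def)
  have supp: "{x. p x \<noteq> x} = set (concat css)"
    using cycle_factorization_moves[OF css(1)] by blast
  have "card {x. p x \<noteq> x} = length (concat css)" using d(1) unfolding supp by (rule distinct_card)
  moreover have "size (cycle_type p) = length css" using cycle_type_eq[OF css(1)] by simp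
  moreover have "p 0 \<noteq> 0 \<longleftrightarrow> 0 \<in> set (concat css)" by (rule cycle_factorization_moves[OF css(1)])
  ultimately show ?thesis
    using word_length_cycle_factorization[OF assms(1) css] sum_cycle_weight[OF d] by simp
qed


section \<open>The growth polynomial\<close>

lemma cycle_type_size_sum:
  assumes "cycle_factorization css p"
  shows "size (cycle_type p) = length css" "card {x. p x \<noteq> x} = sum_mset (cycle_type p)"
proof -
  show "size (cycle_type p) = length css" using cycle_type_eq[OF assms] by simp
  have "{x. p x \<noteq> x} = set (concat css)" using cycle_factorization_moves[OF assms] by blast
  moreover have "distinct (concat css)" using assms by (simp add: cycle_factorization_def)
  ultimately have "card {x. p x \<noteq> x} = length (concat css)" by (metis distinct_card)
  also have "\<dots> = sum_mset (cycle_type p)"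
    unfolding cycle_type_eq[OF assms] sum_mset_sum_list by (simp add: length_concat)
  finally show "card {x. p x \<noteq> x} = sum_mset (cycle_type p)" .
qed

lemma cycle_type_ge_2:
  assumes "cycle_factorization css p" "l \<in># cycle_type p"
  shows "2 \<le> l"
  using assms(2) cycle_factorization_length[OF assms(1)] unfolding cycle_type_eq[OF assms(1)] by auto

section \<open>Derangements of arbitrary finite sets\<close>

lemma derangement_iff_cycle_factorization:
  "p permutes A \<and> (\<forall>x\<in>A. p x \<noteq> x) \<and> disjoint_cycle_product k p \<longleftrightarrow>
    (\<exists>css. cycle_factorization css p \<and> length css = k \<and> set (concat css) = A)"
proof
  assume p: "p permutes A \<and> (\<forall>x\<in>A. p x \<noteq> x) \<and> disjoint_cycle_product k p"
  then obtain css where css: "cycle_factorization css p" "length css = k"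
    unfolding disjoint_cycle_product_iff by blast
  have "x \<in> set (concat css) \<longleftrightarrow> x \<in> A" for x
    unfolding cycle_factorization_moves[OF css(1), symmetric] using p permutes_not_in by metis
  then have "set (concat css) = A" unfolding set_eq_iff by blast
  with css show "\<exists>css. cycle_factorization css p \<and> length css = k \<and> set (concat css) = A" by metis
next
  assume "\<exists>css. cycle_factorization css p \<and> length css = k \<and> set (concat css) = A"
  then obtain css where css: "cycle_factorization css p" "length css = k" "set (concat css) = A"
    by metis
  have "p permutes A" using cycle_factorization_permutes[OF css(1)] css(3) by simp
  moreover have "\<forall>x\<in>A. p x \<noteq> x" using cycle_factorization_moves[OF css(1)] css(3) by metis
  ultimately show "p permutes A \<and> (\<forall>x\<in>A. p x \<noteq> x) \<and> disjoint_cycle_product k p"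
    unfolding disjoint_cycle_product_iff using css(1,2) by metis
qed

text \<open>\<open>num_derangements\<close> counts on \<open>{1..m}\<close> only, whereas the
  support of a permutation is an arbitrary finite set; hence the parameter \<open>A\<close>.\<close>

definition derangements :: "nat set \<Rightarrow> nat \<Rightarrow> (nat \<Rightarrow> nat) set" where
  "derangements A k = {p. p permutes A \<and> (\<forall>x\<in>A. p x \<noteq> x) \<and> disjoint_cycle_product k p}"

lemma derangements_conj:
  assumes "bij h" "p \<in> derangements A k"
  shows "h \<circ> p \<circ> inv_into UNIV h \<in> derangements (h ` A) k"
proof -
  obtain css where css: "cycle_factorization css p" "length css = k" "set (concat css) = A"
    using assms(2) unfolding derangements_def mem_Collect_eq derangement_iff_cycle_factorization
    by metis
  have "set (concat (map (map h) css)) = h ` A" unfolding css(3)[symmetric] by auto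
  then show ?thesis
    using cycle_factorization_conj[OF css(1) assms(1)] css(2)
    unfolding derangements_def mem_Collect_eq derangement_iff_cycle_factorization
    by (metis length_map)
qed

text \<open>Conjugation by a bijection that carries \<open>{1..m}\<close> to \<open>A\<close>
  matches the two sets of derangements and preserves the number of cycles.\<close>

lemma card_derangements:
  assumes "finite A"
  shows "card (derangements A k) = num_derangements k (card A)"
proof -
  define m where "m = card A"
  obtain f where f: "bij_betw f {1..m} A"
    using assms by (metis m_def card_atLeastAtMost diff_Suc_1 finite_atLeastAtMost bij_betw_iff_card)
  have fin: "finite ({1..m} \<union> A)" using assms by simp
  \<comment> \<open>Extending \<open>f\<close> to a permutation of the union yields a bijection of
    all naturals, so \<open>derangements_conj\<close> applies to \<open>h\<close> and to its
    inverse.\<close>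
  obtain h where h: "h permutes ({1..m} \<union> A)" "\<And>x. x \<in> {1..m} \<Longrightarrow> h x = f x"
    using extend_bij_betw[OF fin f Un_upper1 Un_upper2] by blast
  have bij: "bij h" using permutes_bij[OF h(1)] .
  have hA: "h ` {1..m} = A" using f h(2) unfolding bij_betw_def by (metis image_cong)
  have invA: "inv_into UNIV h ` A = {1..m}"
    unfolding hA[symmetric] using bij by (simp add: image_inv_f_f bij_is_inj)
  note inv = bij_imp_bij_inv[OF bij] inv_inv_eq[OF bij]
  have 1: "inv_into UNIV h \<circ> (h \<circ> p \<circ> inv_into UNIV h) \<circ> h = p" for p
    using bij_is_inj[OF bij] by (simp add: fun_eq_iff)
  have 2: "h \<circ> (inv_into UNIV h \<circ> p \<circ> h) \<circ> inv_into UNIV h = p" for p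
    using bij_is_surj[OF bij] by (simp add: fun_eq_iff surj_f_inv_f)
  have "bij_betw (\<lambda>p. h \<circ> p \<circ> inv_into UNIV h) (derangements {1..m} k) (derangements A k)"
  proof (rule bij_betw_byWitness[where f' = "\<lambda>p. inv_into UNIV h \<circ> p \<circ> h"])
    show "(\<lambda>p. h \<circ> p \<circ> inv_into UNIV h) ` derangements {1..m} k \<subseteq> derangements A k"
      using derangements_conj[OF bij, of _ "{1..m}" k] unfolding hA by blast
    show "(\<lambda>p. inv_into UNIV h \<circ> p \<circ> h) ` derangements A k \<subseteq> derangements {1..m} k"
      using derangements_conj[OF inv(1), of _ A k] unfolding invA inv(2) by blast
  qed (simp_all only: 1 2 ball_triv simp_thms refl)
  then show ?thesis
    using bij_betw_same_card[of _ "derangements {1..m} k" "derangements A k"]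
    by (simp add: m_def num_derangements_def derangements_def)
qed

text \<open>The permutations with support \<open>A\<close> and \<open>k\<close> cycles are the
  derangements of \<open>A\<close> with \<open>k\<close> cycles, so grouping by \<open>k\<close>
  produces the coefficients. The parameter \<open>d\<close> is the saving due to \<open>0\<close>,
  later 0 or 2.\<close>

lemma sum_over_support:
  fixes n :: nat and d :: nat and A :: "nat set"
  assumes A: "A \<subseteq> {0..<n}" "A \<noteq> {}"
  shows "(\<Sum>p | p permutes {0..<n} \<and> {x. p x \<noteq> x} = A.
      monom (1::int) (card {x. p x \<noteq> x} + size (cycle_type p) - d)) =
    (\<Sum>k = 1..card A div 2. monom (int (num_derangements k (card A))) (card A + k - d))"
proof -
  have fin: "finite A" using A finite_subset by blast
  let ?P = "{p. p permutes {0..<n} \<and> {x. p x \<noteq> x} = A}"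
  have finP: "finite ?P" by (rule finite_subset[OF _ finite_permutations[of "{0..<n}"]]) auto
  have der: "{p \<in> ?P. size (cycle_type p) = k} = derangements A k" for k
  proof (intro equalityI subsetI)
    fix p assume "p \<in> {p \<in> ?P. size (cycle_type p) = k}"
    then have p: "p permutes {0..<n}" "{x. p x \<noteq> x} = A" "size (cycle_type p) = k" by auto
    obtain css where css: "cycle_factorization css p" 
      using cycle_factorization_exists[OF p(1)] by blast
    have "set (concat css) = A" using cycle_factorization_moves[OF css] p(2) by blast
    then show "p \<in> derangements A k"
      using css cycle_type_size_sum(1)[OF css] p(3)
      unfolding derangements_def mem_Collect_eq derangement_iff_cycle_factorization by metis
  next
    fix p assume p: "p \<in> derangements A k"
    then obtain css where css: "cycle_factorization css p" "length css = k" "set (concat css) = A"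
      unfolding derangements_def mem_Collect_eq derangement_iff_cycle_factorization by metis
    have "p permutes {0..<n}" using p A(1) permutes_subset unfolding derangements_def by blast
    moreover have "{x. p x \<noteq> x} = A" using cycle_factorization_moves[OF css(1), unfolded css(3)] by simp
    ultimately show "p \<in> {p \<in> ?P. size (cycle_type p) = k}"
      using css(2) cycle_type_size_sum(1)[OF css(1)] by simp
  qed
  have "(\<lambda>p. size (cycle_type p)) ` ?P \<subseteq> {1..card A div 2}"
  proof (rule image_subsetI)
    fix p assume "p \<in> ?P"
    then have p: "p permutes {0..<n}" "{x. p x \<noteq> x} = A" by auto
    obtain css where css: "cycle_factorization css p" 
      using cycle_factorization_exists[OF p(1)] by blast
    \<comment> \<open>Each cycle uses at least two points, which gives the upper limit for
      \<open>k\<close>; the lower limit comes from \<open>A\<close> being nonempty.\<close>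
    have "2 * size M \<le> sum_mset M" if "\<forall>l\<in>#M. 2 \<le> l" for M :: "nat multiset"
      using that by (induction M) auto
    then have "2 * size (cycle_type p) \<le> card A"
      using cycle_type_size_sum(2)[OF css] cycle_type_ge_2[OF css] p(2) by simp
    moreover have "size (cycle_type p) \<noteq> 0"
      using cycle_type_size_sum(2)[OF css] A(2) fin p(2) by auto
    ultimately show "size (cycle_type p) \<in> {1..card A div 2}"
      unfolding atLeastAtMost_iff by linarith
  qed
  then have "(\<Sum>p\<in>?P. monom (1::int) (card {x. p x \<noteq> x} + size (cycle_type p) - d)) =
    (\<Sum>k = 1..card A div 2. \<Sum>p\<in>{p \<in> ?P. size (cycle_type p) = k}.
      monom 1 (card {x. p x \<noteq> x} + size (cycle_type p) - d))"
    by (intro sum.group[symmetric] finP) simp_all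
  also have "\<dots> = (\<Sum>k = 1..card A div 2. \<Sum>p\<in>{p \<in> ?P. size (cycle_type p) = k}.
      monom 1 (card A + k - d))"
    by (intro sum.cong refl) auto
  also have "\<dots> = (\<Sum>k = 1..card A div 2. monom (int (num_derangements k (card A))) (card A + k - d))"
    unfolding der by (simp add: card_derangements[OF fin] of_nat_monom mult_monom flip: monom_0)
  finally show ?thesis .
qed

lemma sum_Pow_card:
  fixes g :: "nat \<Rightarrow> 'a :: comm_semiring_1"
  assumes "finite X"
  shows "(\<Sum>A\<in>Pow X. g (card A)) = (\<Sum>m = 0..card X. of_nat (card X choose m) * g m)"
proof -
  have "card ` Pow X \<subseteq> {0..card X}" using assms by (auto intro: card_mono)
  then have "(\<Sum>A\<in>Pow X. g (card A)) = (\<Sum>m = 0..card X. \<Sum>A\<in>{A \<in> Pow X. card A = m}. g (card A))"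
    using assms by (intro sum.group[symmetric]) auto
  also have "\<dots> = (\<Sum>m = 0..card X. \<Sum>A\<in>{A. A \<subseteq> X \<and> card A = m}. g m)"
    by (intro sum.cong) auto
  finally show ?thesis using assms by (simp add: n_subsets)
qed

text \<open>Permutations are grouped by support. The empty support gives the summand 1, the supports
  avoiding \<open>0\<close> the first double sum, and those containing \<open>0\<close> the second,
  where only \<open>m - 1\<close> points remain to be chosen.\<close>

lemma growth_poly_star_transpositions:
  assumes "n \<ge> 1"
  shows "growth_poly (Sym n) (star_transpositions n) =
           1
           + (\<Sum>m = 2..n - 1. of_nat ((n - 1) choose m) *
                (\<Sum>k = 1..m div 2. monom (int (num_derangements k m)) (m + k)))
           + (\<Sum>m = 2..n. of_nat ((n - 1) choose (m - 1)) *
                (\<Sum>k = 1..m div 2. monom (int (num_derangements k m)) (m + k - 2)))"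
proof -
  \<comment> \<open>The contribution of a single nonempty support of size \<open>m\<close> when the
    saving is \<open>d\<close>; it vanishes for \<open>m < 2\<close>, where the range of
    \<open>k\<close> is empty.\<close>
  define F where "F d m = (\<Sum>k = 1..m div 2. monom (int (num_derangements k m)) (m + k - d))"
    for d m :: nat
  have F01: "F d 0 = 0" "F d (Suc 0) = 0" for d by (simp_all add: F_def)
  define X where "X = {1..n - 1}"
  have X: "finite X" "card X = n - 1" "0 \<notin> X" by (auto simp: X_def)
  have n_eq: "{0..<n} = insert 0 X" using assms by (auto simp: X_def)
  let ?P = "{p. p permutes {0..<n}}"
  let ?w = "\<lambda>p. monom (1::int) (word_length (Sym n) (star_transpositions n) p)"
  let ?supp = "\<lambda>p. {x. p x \<noteq> x}"
  have by_support: "(\<Sum>p | p \<in> ?P \<and> ?supp p = A. ?w p) =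
    (if A = {} then 1 else 0) + F (if 0 \<in> A then 2 else 0) (card A)" if "A \<subseteq> {0..<n}" for A
  proof (cases "A = {}")
    case True
    have "{p. p \<in> ?P \<and> ?supp p = {}} = {id}" by (auto simp: permutes_id)
    moreover have "cycle_type (id :: nat \<Rightarrow> nat) = {#}" by (simp add: cycle_type_def)
    ultimately show ?thesis using True assms F01 permutes_id
      by (simp add: word_length_star_transpositions)
  next
    case False
    have "(\<Sum>p | p \<in> ?P \<and> ?supp p = A. ?w p) =
      (\<Sum>p | p permutes {0..<n} \<and> ?supp p = A.
        monom 1 (card (?supp p) + size (cycle_type p) - (if 0 \<in> A then 2 else 0)))"
      using word_length_star_transpositions[OF assms] by (intro sum.cong) auto
    also have "\<dots> = F (if 0 \<in> A then 2 else 0) (card A)"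
      unfolding F_def using that False by (rule sum_over_support)
    finally show ?thesis using False by simp
  qed
  have "growth_poly (Sym n) (star_transpositions n) = (\<Sum>p\<in>?P. ?w p)"
    by (simp add: growth_poly_def Sym_def)
  also have "\<dots> = (\<Sum>A\<in>Pow {0..<n}. \<Sum>p | p \<in> ?P \<and> ?supp p = A. ?w p)"
    by (rule sum.group[symmetric]) (auto simp: finite_permutations dest: permutes_not_in)
  also have "\<dots> = (\<Sum>A\<in>Pow {0..<n}. (if A = {} then 1 else 0) +
      F (if 0 \<in> A then 2 else 0) (card A))"
    by (intro sum.cong refl by_support) simp
  also have "\<dots> = 1 + (\<Sum>A\<in>Pow {0..<n}. F (if 0 \<in> A then 2 else 0) (card A))"
    by (simp add: sum.distrib)
  \<comment> \<open>Every support is either a subset of \<open>X\<close> or arises from one by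
    inserting \<open>0\<close>.\<close>
  also have "(\<Sum>A\<in>Pow {0..<n}. F (if 0 \<in> A then 2 else 0) (card A)) =
      (\<Sum>A\<in>Pow X. F (if 0 \<in> A then 2 else 0) (card A)) +
      (\<Sum>A\<in>insert 0 ` Pow X. F (if 0 \<in> A then 2 else 0) (card A))"
    unfolding n_eq Pow_insert using X by (intro sum.union_disjoint) auto
  also have "(\<Sum>A\<in>Pow X. F (if 0 \<in> A then 2 else 0) (card A)) = (\<Sum>A\<in>Pow X. F 0 (card A))"
    using X by (intro sum.cong) auto
  also have "\<dots> = (\<Sum>m = 0..n - 1. of_nat ((n - 1) choose m) * F 0 m)"
    unfolding sum_Pow_card[OF X(1), of "F 0"] X(2) ..
  also have "\<dots> = (\<Sum>m = 2..n - 1. of_nat ((n - 1) choose m) * F 0 m)"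
  proof (rule sum.mono_neutral_right)
    show "\<forall>m\<in>{0..n - 1} - {2..n - 1}. of_nat ((n - 1) choose m) * F 0 m = 0"
    proof
      fix m assume "m \<in> {0..n - 1} - {2..n - 1}"
      then have "m = 0 \<or> m = Suc 0" by auto
      then show "of_nat ((n - 1) choose m) * F 0 m = 0" using F01 by auto
    qed
  qed auto
  also have "(\<Sum>A\<in>insert 0 ` Pow X. F (if 0 \<in> A then 2 else 0) (card A)) =
      (\<Sum>A\<in>Pow X. F 2 (Suc (card A)))"
  proof (subst sum.reindex)
    show "inj_on (insert 0) (Pow X)"
      using X(3) by (intro inj_onI) (metis Diff_insert_absorb PowD subsetD)
    show "sum ((\<lambda>A. F (if 0 \<in> A then 2 else 0) (card A)) \<circ> insert 0) (Pow X) =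
        (\<Sum>A\<in>Pow X. F 2 (Suc (card A)))"
    proof (rule sum.cong)
      fix A assume "A \<in> Pow X"
      then have "finite A" "0 \<notin> A" using X finite_subset by auto
      then show "((\<lambda>A. F (if 0 \<in> A then 2 else 0) (card A)) \<circ> insert 0) A = F 2 (Suc (card A))"
        by simp
    qed simp
  qed
  also have "\<dots> = (\<Sum>m = 0..n - 1. of_nat ((n - 1) choose m) * F 2 (Suc m))"
    unfolding sum_Pow_card[OF X(1), of "\<lambda>m. F 2 (Suc m)"] X(2) ..
  \<comment> \<open>Shift the index so that \<open>m\<close> counts the whole support including
    \<open>0\<close>.\<close>
  also have "\<dots> = (\<Sum>m = 1..n. of_nat ((n - 1) choose (m - 1)) * F 2 m)"
    using assms
    by (intro sum.reindex_bij_witness[where i = "\<lambda>m. m - 1" and j = Suc]) auto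
  also have "\<dots> = (\<Sum>m = 2..n. of_nat ((n - 1) choose (m - 1)) * F 2 m)"
  proof (rule sum.mono_neutral_right)
    show "\<forall>m\<in>{1..n} - {2..n}. of_nat ((n - 1) choose (m - 1)) * F 2 m = 0"
    proof
      fix m assume "m \<in> {1..n} - {2..n}"
      then have "m = Suc 0" by auto
      then show "of_nat ((n - 1) choose (m - 1)) * F 2 m = 0" using F01 by auto
    qed
  qed auto
  finally show ?thesis by (simp add: F_def add.assoc)
qed


section \<open>The conjugacy growth polynomial\<close>

text \<open>Disjoint cycles commute. Pointwise: the value at \<open>x\<close> is decided by the one
  entry containing \<open>x\<close>, regardless of its position.\<close>

lemma cycle_factorization_mset_cong:
  assumes "cycle_factorization css p" "mset css' = mset css"
  shows "cycle_factorization css' p"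
proof -
  have set_eq: "set css' = set css" using assms(2) by (rule mset_eq_setD)
  have "mset (concat xss) = sum_mset (image_mset mset (mset xss))" for xss :: "'a list list"
    by (induction xss) simp_all
  then have "mset (concat css') = mset (concat css)" by (simp only: assms(2))
  then have d: "distinct (concat css')"
    using assms(1) mset_eq_imp_distinct_iff by (metis cycle_factorization_def)
  have "p x = cycles_prod css' x" for x
  proof (cases "x \<in> set (concat css)")
    case True
    then obtain cs where cs: "cs \<in> set css" "x \<in> set cs" by auto
    show ?thesis
      unfolding cycle_factorization_inside[OF assms(1) cs]
      by (rule cycles_prod_inside[symmetric]) (use d cs set_eq in simp_all)
  next
    case False
    then show ?thesis
      using cycle_factorization_outside[OF assms(1)] cycles_prod_outside[of x css'] set_eq by simp
  qed
  then have "p = cycles_prod css'" by (rule ext)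
  with d show ?thesis using assms(1) set_eq unfolding cycle_factorization_def by metis
qed

lemma concat_eq_imp_eq:
  "map length xss = map length yss \<Longrightarrow> concat xss = concat yss \<Longrightarrow> xss = yss"
  by (induction xss arbitrary: yss) (auto simp: Cons_eq_map_conv)

lemma split_list_lengths: "\<exists>xss. map length xss = ls \<and> concat xss = xs" if "length xs = sum_list ls"
  using that
proof (induction ls arbitrary: xs)
  case (Cons l ls)
  then have "length (drop l xs) = sum_list ls" by simp
  then obtain xss where "map length xss = ls" "concat xss = drop l xs" using Cons.IH by metis
  with Cons.prems show ?case by (intro exI[of _ "take l xs # xss"]) simp
qed simp

lemma cycle_type_conj:
  assumes "p permutes S" "finite S" "bij h"
  shows "cycle_type (h \<circ> p \<circ> inv_into UNIV h) = cycle_type p"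
proof -
  obtain css where css: "cycle_factorization css p"
    using cycle_factorization_exists[OF assms(1,2)] by metis
  have "map length (map (map h) css) = map length css" by simp
  then show ?thesis
    using cycle_type_eq[OF css] cycle_type_eq[OF cycle_factorization_conj[OF css assms(3)]] by metis
qed

text \<open>Sort factorizations of \<open>p\<close> and \<open>q\<close> by cycle length. Then the
  concatenations can be matched point by point, and a permutation \<open>h\<close> realizing the
  match conjugates \<open>p\<close> to \<open>q\<close>.\<close>

lemma conjugate_if_cycle_type_eq:
  assumes "finite S" "p permutes S" "q permutes S" "cycle_type p = cycle_type q"
  obtains h where "h permutes S" "q = h \<circ> p \<circ> inv_into UNIV h"
proof -
  have sorted: "\<exists>css. cycle_factorization css r \<and> set (concat css) \<subseteq> S \<and>
      map length css = sorted_list_of_multiset (cycle_type r)" if r: "r permutes S" for r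
  proof -
    obtain css where css: "cycle_factorization css r" "set (concat css) \<subseteq> S"
      using cycle_factorization_exists[OF r assms(1)] by metis
    have "cycle_factorization (sort_key length css) r"
      by (rule cycle_factorization_mset_cong[OF css(1)]) simp
    moreover have "set (concat (sort_key length css)) \<subseteq> S" using css(2) by simp
    moreover have "map length (sort_key length css) = sort (map length css)"
      by (rule properties_for_sort[symmetric]) simp_all
    then have "map length (sort_key length css) = sorted_list_of_multiset (cycle_type r)"
      unfolding cycle_type_eq[OF css(1)] sorted_list_of_multiset_mset .
    ultimately show ?thesis by metis
  qed
  obtain css where css: "cycle_factorization css p" "set (concat css) \<subseteq> S"
    "map length css = sorted_list_of_multiset (cycle_type p)"
    using sorted[OF assms(2)] by metis
  obtain css' where css': "cycle_factorization css' q" "set (concat css') \<subseteq> S"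
    "map length css' = sorted_list_of_multiset (cycle_type q)"
    using sorted[OF assms(3)] by metis
  have len: "map length css = map length css'" using css(3) css'(3) assms(4) by simp
  obtain h where h: "h permutes S" "map h (concat css) = concat css'"
  proof (rule extend_map)
    show "length (concat css) = length (concat css')" by (simp only: length_concat len)
  qed (use assms(1) css(1,2) css'(1,2) in \<open>simp_all add: cycle_factorization_def\<close>)
  \<comment> \<open>Both concatenations are cut at the same places, so matching them matches the
    cycles themselves.\<close>
  have "map (map h) css = css'"
    by (rule concat_eq_imp_eq) (use len h(2) in \<open>simp_all add: map_concat comp_def\<close>)
  then have "cycle_factorization css' (h \<circ> p \<circ> inv_into UNIV h)"
    using cycle_factorization_conj[OF css(1) permutes_bij[OF h(1)]] by simp
  then have "q = h \<circ> p \<circ> inv_into UNIV h" using css'(1) by (simp add: cycle_factorization_def)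
  with h(1) show ?thesis by (rule that)
qed

lemma conj_class_Sym:
  assumes "p permutes {0..<n}"
  shows "conj_class (Sym n) p = {q. q permutes {0..<n} \<and> cycle_type q = cycle_type p}"
proof -
  interpret group "Sym n" by (rule group_Sym)
  have conj: "h \<otimes>\<^bsub>Sym n\<^esub> p \<otimes>\<^bsub>Sym n\<^esub> inv\<^bsub>Sym n\<^esub> h = h \<circ> p \<circ> inv_into UNIV h"
    if h: "h permutes {0..<n}" for h
  proof -
    have "inv\<^bsub>Sym n\<^esub> h = inv_into UNIV h"
      using h permutes_inv[OF h] permutes_inv_o(2)[OF h]
      by (intro inv_equality) (simp_all add: Sym_def)
    then show ?thesis by (simp add: Sym_def)
  qed
  have carrier: "carrier (Sym n) = {h. h permutes {0..<n}}" by (simp add: Sym_def)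
  show ?thesis
  proof (intro equalityI subsetI)
    fix q assume "q \<in> conj_class (Sym n) p"
    then obtain h where h: "h permutes {0..<n}" "q = h \<circ> p \<circ> inv_into UNIV h"
      unfolding conj_class_def carrier using conj by auto
    have "q permutes {0..<n}" unfolding h(2)
      using h(1) assms by (intro permutes_compose permutes_inv)
    moreover have "cycle_type q = cycle_type p"
      unfolding h(2) by (rule cycle_type_conj[OF assms _ permutes_bij[OF h(1)]]) simp
    ultimately show "q \<in> {q. q permutes {0..<n} \<and> cycle_type q = cycle_type p}" by simp
  next
    fix q assume "q \<in> {q. q permutes {0..<n} \<and> cycle_type q = cycle_type p}"
    then obtain h where h: "h permutes {0..<n}" "q = h \<circ> p \<circ> inv_into UNIV h"
      using conjugate_if_cycle_type_eq[of "{0..<n}" p q] assms by auto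
    have "q = h \<otimes>\<^bsub>Sym n\<^esub> p \<otimes>\<^bsub>Sym n\<^esub> inv\<^bsub>Sym n\<^esub> h" using conj[OF h(1)] h(2) by simp
    then show "q \<in> conj_class (Sym n) p" unfolding conj_class_def carrier using h(1) by blast
  qed
qed

text \<open>As in \<open>num_partitions\<close>, classes are indexed by the multisets of cycle lengths minus one.\<close>

definition cycle_type_class :: "nat \<Rightarrow> nat multiset \<Rightarrow> (nat \<Rightarrow> nat) set" where
  "cycle_type_class n M = {p. p permutes {0..<n} \<and> cycle_type p = image_mset Suc M}"

text \<open>Adding \<open>size M\<close> restores the cycle lengths, so the bounded quantity is the
  number of moved points. The empty multiset stands for the identity.\<close>

definition reduced_cycle_types :: "nat \<Rightarrow> nat multiset set" where
  "reduced_cycle_types n = {M. 0 \<notin># M \<and> sum_mset M + size M \<le> n}"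

lemma sum_image_mset_Suc: "sum_mset (image_mset Suc M) = sum_mset M + size M"
  by (induction M) auto

text \<open>Cut \<open>0, 1, 2, ...\<close> into consecutive blocks of the prescribed lengths;
  \<open>0\<close> lies in the first block. The witness shows that the class is nonempty and later
  attains the minimal word length.\<close>

lemma cycle_type_class_moving_0:
  assumes "M \<in> reduced_cycle_types n"
  obtains p where "p \<in> cycle_type_class n M" "M \<noteq> {#} \<Longrightarrow> p 0 \<noteq> 0"
proof -
  define ls where "ls = sorted_list_of_multiset (image_mset Suc M)"
  have ls: "mset ls = image_mset Suc M" by (simp add: ls_def)
  have sum: "sum_list ls = sum_mset M + size M"
    unfolding sum_mset_sum_list[symmetric] ls by (rule sum_image_mset_Suc)
  obtain css where css: "map length css = ls" "concat css = [0..<sum_list ls]"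
    using split_list_lengths[of "[0..<sum_list ls]" ls] by auto
  have "2 \<le> l" if "l \<in> set ls" for l
  proof -
    have "l \<in># image_mset Suc M" using that by (simp flip: ls)
    then obtain x where "x \<in># M" "l = Suc x" by auto
    then show ?thesis using assms by (cases x) (auto simp: reduced_cycle_types_def)
  qed
  then have "\<forall>cs\<in>set css. 2 \<le> length cs" unfolding css(1)[symmetric] by simp
  then have cf: "cycle_factorization css (cycles_prod css)"
    unfolding cycle_factorization_def by (simp add: css(2))
  have "sum_list ls \<le> n" using assms sum by (simp add: reduced_cycle_types_def)
  then have "cycles_prod css permutes {0..<n}"
    by (intro cycle_factorization_permutes[OF cf]) (simp add: css(2) del: set_concat)
  moreover have "cycle_type (cycles_prod css) = image_mset Suc M"
    unfolding cycle_type_eq[OF cf] css(1) by (rule ls)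
  moreover have "cycles_prod css 0 \<noteq> 0" if "M \<noteq> {#}"
  proof -
    have "sum_list ls > 0" using that sum by (simp add: nonempty_has_size)
    then show ?thesis unfolding cycle_factorization_moves[OF cf] css(2) by simp
  qed
  ultimately show ?thesis using that by (auto simp: cycle_type_class_def)
qed

lemma bij_betw_cycle_type_class:
  "bij_betw (cycle_type_class n) (reduced_cycle_types n) (conj_classes (Sym n))"
proof -
  have carrier: "carrier (Sym n) = {h. h permutes {0..<n}}" by (simp add: Sym_def)
  have eq: "conj_class (Sym n) p = cycle_type_class n M" if "p \<in> cycle_type_class n M" for p M
    using that conj_class_Sym[of p n] by (auto simp: cycle_type_class_def)
  show ?thesis
  proof (rule bij_betw_imageI)
    show "inj_on (cycle_type_class n) (reduced_cycle_types n)"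
    proof (rule inj_onI)
      fix M N assume M: "M \<in> reduced_cycle_types n" and MN: "cycle_type_class n M = cycle_type_class n N"
      obtain p where p: "p \<in> cycle_type_class n M" using cycle_type_class_moving_0[OF M] by metis
      then have "p \<in> cycle_type_class n N" using MN by simp
      with p have "image_mset Suc M = image_mset Suc N" by (simp add: cycle_type_class_def)
      then have "image_mset (\<lambda>x. x - 1) (image_mset Suc M) = image_mset (\<lambda>x. x - 1) (image_mset Suc N)"
        by (rule arg_cong)
      then show "M = N" by (simp add: multiset.map_comp comp_def)
    qed
    show "cycle_type_class n ` reduced_cycle_types n = conj_classes (Sym n)"
    proof (intro equalityI subsetI)
      fix c assume "c \<in> cycle_type_class n ` reduced_cycle_types n"
      then obtain M where M: "M \<in> reduced_cycle_types n" "c = cycle_type_class n M" by blast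
      then obtain p where p: "p \<in> cycle_type_class n M" using cycle_type_class_moving_0 by metis
      then have "p \<in> carrier (Sym n)" by (simp add: carrier cycle_type_class_def)
      then show "c \<in> conj_classes (Sym n)" unfolding conj_classes_def using M eq[OF p] by blast
    next
      fix c assume "c \<in> conj_classes (Sym n)"
      then obtain p where p: "p permutes {0..<n}" "c = conj_class (Sym n) p"
        unfolding conj_classes_def carrier by blast
      obtain css where css: "cycle_factorization css p"
        using cycle_factorization_exists[OF p(1)] by blast
      \<comment> \<open>All cycle lengths are at least 2, so subtracting one is undone by
        \<open>Suc\<close> and leaves no zero.\<close>
      define M where "M = image_mset (\<lambda>l. l - 1) (cycle_type p)"
      have "image_mset Suc M = image_mset id (cycle_type p)"
        unfolding M_def multiset.map_comp
      proof (rule image_mset_cong)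
        fix l assume "l \<in># cycle_type p"
        then have "2 \<le> l" by (rule cycle_type_ge_2[OF css])
        then show "(Suc \<circ> (\<lambda>l. l - 1)) l = id l" by simp
      qed
      then have SM: "image_mset Suc M = cycle_type p" by simp
      have "0 \<notin># M"
        using cycle_type_ge_2[OF css] unfolding M_def by fastforce
      moreover have "sum_mset M + size M \<le> n"
      proof -
        have "sum_mset M + size M = card {x. p x \<noteq> x}"
          unfolding cycle_type_size_sum(2)[OF css] SM[symmetric]
          by (rule sum_image_mset_Suc[symmetric])
        also have "\<dots> \<le> card {0..<n}"
          using p(1) permutes_not_in by (intro card_mono) fastforce+
        finally show ?thesis by simp
      qed
      ultimately have "M \<in> reduced_cycle_types n" by (simp add: reduced_cycle_types_def)
      moreover have "p \<in> cycle_type_class n M" using p(1) SM by (simp add: cycle_type_class_def)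
      ultimately show "c \<in> cycle_type_class n ` reduced_cycle_types n"
        using eq p(2) by blast
    qed
  qed
qed

text \<open>Within a class the word length varies only by the saving of 2 for moving
  \<open>0\<close>, and every nontrivial class has a member that moves \<open>0\<close>.\<close>

lemma conj_length_cycle_type_class:
  assumes "n \<ge> 1" "M \<in> reduced_cycle_types n" "p \<in> cycle_type_class n M"
  shows "conj_length (Sym n) (star_transpositions n) p =
    (if M = {#} then 0 else 2 * size M - 2 + sum_mset M)"
proof -
  have class_eq: "conj_class (Sym n) p = cycle_type_class n M"
    using assms(3) conj_class_Sym[of p n] by (auto simp: cycle_type_class_def)
  have wl: "word_length (Sym n) (star_transpositions n) q =
      sum_mset M + 2 * size M - (if q 0 \<noteq> 0 then 2 else 0)" if q: "q \<in> cycle_type_class n M" for q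
  proof -
    have q': "q permutes {0..<n}" "cycle_type q = image_mset Suc M"
      using q by (simp_all add: cycle_type_class_def)
    obtain css where css: "cycle_factorization css q"
      using cycle_factorization_exists[OF q'(1)] by blast
    have "card {x. q x \<noteq> x} = sum_mset M + size M"
      unfolding cycle_type_size_sum(2)[OF css] q'(2) by (rule sum_image_mset_Suc)
    then show ?thesis
      using word_length_star_transpositions[OF assms(1) q'(1)] by (simp add: q'(2))
  qed
  obtain q where q: "q \<in> cycle_type_class n M" "M \<noteq> {#} \<Longrightarrow> q 0 \<noteq> 0"
    using cycle_type_class_moving_0[OF assms(2)] by metis
  have "finite (cycle_type_class n M)"
    by (rule finite_subset[OF _ finite_permutations[of "{0..<n}"]]) (auto simp: cycle_type_class_def)
  then have "Min (word_length (Sym n) (star_transpositions n) ` cycle_type_class n M) =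
      word_length (Sym n) (star_transpositions n) q"
  proof (intro Min_eqI)
    fix y assume "y \<in> word_length (Sym n) (star_transpositions n) ` cycle_type_class n M"
    then obtain r where "r \<in> cycle_type_class n M"
      "y = word_length (Sym n) (star_transpositions n) r" by blast
    then show "word_length (Sym n) (star_transpositions n) q \<le> y"
      using wl q by (cases "M = {#}") auto
  qed (use q in auto)
  \<comment> \<open>Ensures that \<open>2 * size M - 2\<close> is not truncated, so the summands may
    be regrouped.\<close>
  moreover have "size M \<noteq> 0" if "M \<noteq> {#}" using that by simp
  ultimately show ?thesis unfolding conj_length_def class_eq using wl[OF q(1)] q(2)
    by (cases "M = {#}") (auto simp: nonempty_has_size Suc_le_eq)
qed

section \<open>Summation over the number and the sum of the parts\<close>

lemma size_le_sum_mset: "0 \<notin># M \<Longrightarrow> size M \<le> sum_mset M" for M :: "nat multiset"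
proof (induction M)
  case (add x M)
  then show ?case by (cases x) auto
qed simp

lemma conj_growth_poly_star_transpositions:
  assumes "n \<ge> 1"
  shows "conj_growth_poly (Sym n) (star_transpositions n) =
           1
           + (\<Sum>k = 1..n div 2. monom 1 (2 * k - 2) *
                (\<Sum>j = k..n - k. monom (int (num_partitions k j)) j))"
proof -
  let ?T = "reduced_cycle_types n - {{#}}"
  \<comment> \<open>Pairs of number of parts \<open>k\<close> and sum \<open>j\<close>. The bound on
    moved points reads \<open>j + k \<le> n\<close>; with \<open>k \<le> j\<close> it gives
    \<open>k \<le> n div 2\<close>.\<close>
  let ?I = "SIGMA k:{1..n div 2}. {k..n - k}"
  have "finite (conj_classes (Sym n))" by (simp add: conj_classes_def finite_Sym)
  then have fin: "finite (reduced_cycle_types n)"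
    using bij_betw_finite[OF bij_betw_cycle_type_class] by blast
  have "conj_growth_poly (Sym n) (star_transpositions n) =
    (\<Sum>M\<in>reduced_cycle_types n.
      monom 1 (conj_length (Sym n) (star_transpositions n) (SOME g. g \<in> cycle_type_class n M)))"
    unfolding conj_growth_poly_def by (rule sum.reindex_bij_betw[OF bij_betw_cycle_type_class, symmetric])
  also have "\<dots> = (\<Sum>M\<in>reduced_cycle_types n. monom 1 (if M = {#} then 0 else 2 * size M - 2 + sum_mset M))"
  proof (rule sum.cong)
    fix M assume M: "M \<in> reduced_cycle_types n"
    then obtain p where "p \<in> cycle_type_class n M" using cycle_type_class_moving_0 by metis
    \<comment> \<open>The chosen representative does not matter, since the formula for
      \<open>conj_length\<close> depends on \<open>M\<close> only.\<close>
    then have "(SOME g. g \<in> cycle_type_class n M) \<in> cycle_type_class n M" by (rule someI[where P = "\<lambda>g. g \<in> cycle_type_class n M"])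
    then show "monom (1::int) (conj_length (Sym n) (star_transpositions n) (SOME g. g \<in> cycle_type_class n M)) =
      monom 1 (if M = {#} then 0 else 2 * size M - 2 + sum_mset M)"
      by (simp only: conj_length_cycle_type_class[OF assms M])
  qed simp
  also have "\<dots> = 1 + (\<Sum>M\<in>?T. monom 1 (if M = {#} then 0 else 2 * size M - 2 + sum_mset M))"
    using fin by (subst sum.remove[of _ "{#}"]) (auto simp: reduced_cycle_types_def)
  also have "(\<Sum>M\<in>?T. monom (1::int) (if M = {#} then 0 else 2 * size M - 2 + sum_mset M)) =
      (\<Sum>x\<in>?I. \<Sum>M\<in>{M \<in> ?T. (size M, sum_mset M) = x}.
        monom 1 (if M = {#} then 0 else 2 * size M - 2 + sum_mset M))"
  proof (rule sum.group[symmetric])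
    show "(\<lambda>M. (size M, sum_mset M)) ` ?T \<subseteq> ?I"
    proof (rule image_subsetI)
      fix M assume M: "M \<in> ?T"
      then have "0 \<notin># M" "sum_mset M + size M \<le> n" "0 < size M"
        by (auto simp: reduced_cycle_types_def nonempty_has_size)
      then show "(size M, sum_mset M) \<in> ?I" using size_le_sum_mset[of M] by auto
    qed
  qed (use fin in auto)
  also have "\<dots> = (\<Sum>(k, j)\<in>?I. monom (int (num_partitions k j)) (2 * k - 2 + j))"
  proof (rule sum.cong[OF refl])
    fix x assume x: "x \<in> ?I"
    obtain k j where kj: "x = (k, j)" by (cases x)
    \<comment> \<open>For a pair in \<open>?I\<close> the size constraint holds automatically and
      \<open>k \<ge> 1\<close> excludes the empty multiset, so all partitions of \<open>j\<close>
      into \<open>k\<close> parts are counted.\<close>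
    have *: "{M \<in> ?T. (size M, sum_mset M) = x} = {M. size M = k \<and> sum_mset M = j \<and> 0 \<notin># M}"
      using x by (auto simp: kj reduced_cycle_types_def)
    have "(\<Sum>M\<in>{M \<in> ?T. (size M, sum_mset M) = x}.
        monom (1::int) (if M = {#} then 0 else 2 * size M - 2 + sum_mset M)) =
      (\<Sum>M\<in>{M \<in> ?T. (size M, sum_mset M) = x}. monom 1 (2 * k - 2 + j))"
      by (rule sum.cong) (auto simp: kj)
    also have "\<dots> = monom (int (num_partitions k j)) (2 * k - 2 + j)"
      unfolding * num_partitions_def by (simp add: of_nat_monom mult_monom)
    finally show "(\<Sum>M\<in>{M \<in> ?T. (size M, sum_mset M) = x}.
        monom (1::int) (if M = {#} then 0 else 2 * size M - 2 + sum_mset M)) =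
      (case x of (k, j) \<Rightarrow> monom (int (num_partitions k j)) (2 * k - 2 + j))"
      by (simp add: kj)
  qed
  also have "\<dots> = (\<Sum>k = 1..n div 2. \<Sum>j = k..n - k. monom (int (num_partitions k j)) (2 * k - 2 + j))"
    by (rule sum.Sigma[symmetric]) auto
  finally show ?thesis by (simp add: sum_distrib_left mult_monom)
qed

theorem proposition22:
  fixes n :: nat
  assumes "n \<ge> 1"
  shows "growth_poly (Sym n) (star_transpositions n) =
           1
           + (\<Sum>m = 2..n - 1. of_nat ((n - 1) choose m) *
                (\<Sum>k = 1..m div 2. monom (int (num_derangements k m)) (m + k)))
           + (\<Sum>m = 2..n. of_nat ((n - 1) choose (m - 1)) *
                (\<Sum>k = 1..m div 2. monom (int (num_derangements k m)) (m + k - 2)))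
         \<and>
         conj_growth_poly (Sym n) (star_transpositions n) =
           1
           + (\<Sum>k = 1..n div 2. monom 1 (2 * k - 2) *
                (\<Sum>j = k..n - k. monom (int (num_partitions k j)) j))"
  using growth_poly_star_transpositions[OF assms] conj_growth_poly_star_transpositions[OF assms] ..

end
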